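(* Let $0<p<1$ and $q=1-p$. For $n\ge 1$ and $i,j\ge 0$ let $\mathrm{pr}(i,j,n)$ be the probability that, at a circular table for $n$ people, exactly $i$ guests are napkinless and exactly $j$ guests are frustrated. Then $\mathrm{pr}(i,j,n)$ is the coefficient of $x^i y^j z^n$ in (the power series expansion in $z$ of) $$C(x,y,z)=\frac{pqyz\big((x-y)e^{yz}+(qy^2+py-x)e^{pyz}+(py^2+qy-x)e^{qyz}+x\big)}{D},$$ where $$D=pq(y-x)e^{yz}+(qx-pqy-q^2y^2)e^{pyz}+(px-pqy-p^2y^2)e^{qyz}+pq\big(y(y-1)^2+x(1-yz)\big)+y^2-x.$$
   Context: Circular table model. There are $n$ places labelled $1,\dots,n$ counter-clockwise around a circular table; place $i-1$ is to the left of place $i$ and place $i+1$ is to its right (indices cyclic, so place $n$ is to the left of place $1$). There are $n$ napkins, exactly one between each pair of cyclically consecutive places, so each place has a left napkin and a right napkin (for $n=1$ these are the same single napkin). The guests sit down one at a time in uniformly random order. Independently, each guest prefers the left napkin with probability $p$ and the right napkin with probability $q=1-p$. On sitting down, a guest takes his preferred napkin if it is available; otherwise he takes the other adjacent napkin if that one is available; otherwise he gets no napkin. A guest is napkinless if he gets no napkin, and frustrated if he gets a napkin but not the one he prefers. Equivalently, the order and the preferences are encoded by a signed permutation $\pi$ of $\{1,\dots,n\}$: $|\pi(i)|$ is the arrival rank of the guest at place $i$, and the sign of $\pi(i)$ is negative if that guest prefers left and positive if he prefers right. Thus, if $|\pi|_-$ and $|\pi|_+$ are the numbers of negative and positive entries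 of $\pi$, then $\pi$ occurs with probability $p^{|\pi|_-}q^{|\pi|_+}/n!$. *)

theory Defs
  imports
    "HOL-Probability.Probability"
    "HOL-Computational_Algebra.Computational_Algebra"
    "HOL-Combinatorics.Multiset_Permutations"
begin

text \<open>
  Places are labelled \<open>1, \<dots>, n\<close>. Napkin \<open>k\<close> lies between place \<open>k\<close> and the place to its left,
  so the left napkin of place \<open>k\<close> is \<open>k\<close> and its right napkin is the left napkin of the cyclically
  next place. For \<open>n = 1\<close> both are napkin \<open>1\<close>.
\<close>

definition left_napkin :: "nat \<Rightarrow> nat" where
  "left_napkin k = k"

definition right_napkin :: "nat \<Rightarrow> nat \<Rightarrow> nat" where
  "right_napkin n k = (if k = n then 1 else k + 1)"

definition preferred_napkin :: "nat \<Rightarrow> (nat \<Rightarrow> bool) \<Rightarrow> nat \<Rightarrow> nat" where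
  "preferred_napkin n prefers_left k = (if prefers_left k then left_napkin k else right_napkin n k)"

definition other_napkin :: "nat \<Rightarrow> (nat \<Rightarrow> bool) \<Rightarrow> nat \<Rightarrow> nat" where
  "other_napkin n prefers_left k = (if prefers_left k then right_napkin n k else left_napkin k)"

datatype outcome = Content | Frustrated | Napkinless

text \<open>
  The argument \<open>A\<close> is the set of napkins still available, and the list gives the places in the order
  in which they become occupied; the result lists the outcomes of these guests in the same order.
\<close>

fun seating :: "nat \<Rightarrow> (nat \<Rightarrow> bool) \<Rightarrow> nat set \<Rightarrow> nat list \<Rightarrow> outcome list" where
  "seating n prefers_left A [] = []"
| "seating n prefers_left A (k # ks) =
    (let a = preferred_napkin n prefers_left k; b = other_napkin n prefers_left k in
     if a \<in> A then Content # seating n prefers_left (A - {a}) ks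
     else if b \<in> A then Frustrated # seating n prefers_left (A - {b}) ks
     else Napkinless # seating n prefers_left A ks)"

definition table_pmf :: "real \<Rightarrow> nat \<Rightarrow> (nat list \<times> (nat \<Rightarrow> bool)) pmf" where
  "table_pmf p n =
    pair_pmf (pmf_of_set (permutations_of_set {1..n})) (Pi_pmf {1..n} False (\<lambda>_. bernoulli_pmf p))"

definition pr :: "real \<Rightarrow> nat \<Rightarrow> nat \<Rightarrow> nat \<Rightarrow> real" where
  "pr p i j n = measure_pmf.prob (table_pmf p n)
    {(order, prefers_left).
      count_list (seating n prefers_left {1..n} order) Napkinless = i \<and>
      count_list (seating n prefers_left {1..n} order) Frustrated = j}"

text \<open>
  Elements of \<^typ>\<open>real poly poly\<close> are read as polynomials in \<open>x\<close> whose coefficients are polynomials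
  in \<open>y\<close>. The constant term of the denominator \<open>gf_D\<close> is \<open>p q y\<^sup>3\<close>, which is not a unit among the power
  series in \<open>x\<close>, \<open>y\<close>. It is a unit in the field of rational functions in \<open>x\<close> and \<open>y\<close> when
  \<open>p q \<noteq> 0\<close>, so the expansion in \<open>z\<close> takes place over that field.
\<close>

type_synonym ratfun = "real poly poly fract"

definition ratfun_const :: "real \<Rightarrow> ratfun" where
  "ratfun_const c = to_fract [:[:c:]:]"

definition ratfun_x :: ratfun where
  "ratfun_x = to_fract [:0, 1:]"

definition ratfun_y :: ratfun where
  "ratfun_y = to_fract [:[:0, 1:]:]"

definition gf_N :: "real \<Rightarrow> real \<Rightarrow> ratfun fps" where
  "gf_N p' q' =
    (let P = ratfun_const p'; Q = ratfun_const q'; X = ratfun_x; Y = ratfun_y;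
         p = fps_const P; q = fps_const Q; x = fps_const X; y = fps_const Y; z = fps_X
     in p * q * y * z *
        ((x - y) * fps_exp Y
         + (q * y^2 + p * y - x) * fps_exp (P * Y)
         + (p * y^2 + q * y - x) * fps_exp (Q * Y)
         + x))"

definition gf_D :: "real \<Rightarrow> real \<Rightarrow> ratfun fps" where
  "gf_D p' q' =
    (let P = ratfun_const p'; Q = ratfun_const q'; X = ratfun_x; Y = ratfun_y;
         p = fps_const P; q = fps_const Q; x = fps_const X; y = fps_const Y; z = fps_X
     in p * q * (y - x) * fps_exp Y
        + (q * x - p * q * y - q^2 * y^2) * fps_exp (P * Y)
        + (p * x - p * q * y - p^2 * y^2) * fps_exp (Q * Y)
        + p * q * (y * (y - 1)^2 + x * (1 - y * z))
        + y^2 - x)"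

definition gf_C :: "real \<Rightarrow> real \<Rightarrow> ratfun fps" where
  "gf_C p q = gf_N p q / gf_D p q"

end

theory Submission
  imports Defs
begin

text \<open>
  Weigh every outcome by \<open>x\<close> per napkinless and \<open>y\<close> per frustrated guest; the coefficient of
  \<open>z\<^sup>n\<close> in question is then the mean weight at a table for \<open>n\<close>.

  A guest who sits down within a row of empty places splits it into the places on his left and those
  on his right, and no napkin is within reach of both parts. A uniformly random order of arrival induces uniformly random orders
  on the two parts, so the mean weight is multiplicative over them (\<open>mean_weight_Un\<close>).
  Hence the mean weight of \<open>m\<close> consecutive empty places with all napkins between them present depends
  only on \<open>m\<close> and on whether the two napkins at the ends are present, and it satisfies a recursion
  over the first arrival (\<open>segment\<close>, \<open>mean_weight_arc\<close>). The first guest at a circular table always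
  gets the preferred napkin and leaves an arc that lacks one end napkin (\<open>mean_weight_circle\<close>).

  Let \<open>B\<close>, \<open>L\<close>, \<open>R\<close>, \<open>N\<close> be the generating functions in \<open>z\<close> of arcs where both, only the left, only
  the right, or neither of the end napkins is present; \<open>N\<close> omits the empty arc. The recursions say
  \<open>B' = (p L + q R) B\<close>, \<open>L' = p L\<^sup>2 + q B N + q y L\<close>, \<open>R' = q R\<^sup>2 + p N B + p y R\<close> and
  \<open>N' = x + (p L + q R + y) N\<close>, where \<open>z (p L + q R)\<close> is the function wanted. This Riccati system
  becomes linear in \<open>U = 1/B\<close>, \<open>M = L/B\<close>, \<open>K = R/B\<close>, \<open>E = L R/B - N\<close>:
  \<open>E' = y E - x\<close>, \<open>M' = q y M - q E\<close>, \<open>K' = p y K - p E\<close> and \<open>U' = - (p M + q K)\<close>.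
  Solving it gives exponentials, and \<open>p L + q R = (p M + q K)/U\<close> is the asserted quotient, whose
  denominator is \<open>p q y\<^sup>3 U\<close> (\<open>denominator_mult_segment_gf\<close>).
\<close>

section \<open>The mean weight of a set of places\<close>

definition napkins :: "nat \<Rightarrow> nat set \<Rightarrow> nat set" where
  "napkins n I = left_napkin ` I \<union> right_napkin n ` I"

text \<open>
  The weights live in an arbitrary field of characteristic \<open>0\<close>, so that the preferences and the
  indeterminates \<open>x\<close> and \<open>y\<close> can be treated on the same footing as rational functions.
\<close>

locale napkin_weights =
  fixes p q x y :: "'a::field_char_0"
  assumes p_plus_q: "p + q = 1"
begin

text \<open>
  The argument \<open>F\<close> maps the set of napkins that remain to the weight of all later arrivals.
\<close>

definition settle :: "nat \<Rightarrow> nat \<Rightarrow> (nat set \<Rightarrow> 'a) \<Rightarrow> nat set \<Rightarrow> 'a" where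
  "settle a b F A =
     (if a \<in> A then F (A - {a}) else if b \<in> A then y * F (A - {b}) else x * F A)"

definition arrive :: "nat \<Rightarrow> nat \<Rightarrow> (nat set \<Rightarrow> 'a) \<Rightarrow> nat set \<Rightarrow> 'a" where
  "arrive n k F A =
     p * settle (left_napkin k) (right_napkin n k) F A
     + q * settle (right_napkin n k) (left_napkin k) F A"

lemma arrive_sum: "arrive n k (\<lambda>A. \<Sum>i\<in>S. F i A) A = (\<Sum>i\<in>S. arrive n k (F i) A)"
  by (simp add: arrive_def settle_def sum.distrib sum_distrib_left)

lemma arrive_scale: "arrive n k (\<lambda>A. F A * c) A = arrive n k F A * c"
  by (simp add: arrive_def settle_def algebra_simps)

lemma arrive_cong:
  assumes "\<And>B. B \<subseteq> A \<Longrightarrow> A - B \<subseteq> napkins n {k} \<Longrightarrow> F B = G B"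
  shows "arrive n k F A = arrive n k G A"
proof -
  have "F (A - {a}) = G (A - {a})" if "a \<in> napkins n {k}" for a
    using that by (intro assms) auto
  moreover have "F A = G A" by (intro assms) auto
  ultimately show ?thesis
    by (simp add: arrive_def settle_def napkins_def)
qed

lemma arrive_local:
  assumes "A \<inter> napkins n {k} = B \<inter> napkins n {k}"
    and "\<And>a. F (A - {a}) = F (B - {a})" and "F A = F B"
  shows "arrive n k F A = arrive n k F B"
proof -
  have "left_napkin k \<in> A \<longleftrightarrow> left_napkin k \<in> B" "right_napkin n k \<in> A \<longleftrightarrow> right_napkin n k \<in> B"
    using assms(1) by (auto simp: napkins_def)
  then show ?thesis
    by (simp add: arrive_def settle_def assms(2,3))
qed

primrec order_weight :: "nat \<Rightarrow> nat list \<Rightarrow> nat set \<Rightarrow> 'a" where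
  "order_weight n [] A = 1"
| "order_weight n (k # ks) A = arrive n k (order_weight n ks) A"

text \<open>
  Guests only ever inspect their own two napkins, which is the source of independence between
  places that are far apart.
\<close>

lemma order_weight_local:
  "A \<inter> napkins n (set ks) = B \<inter> napkins n (set ks) \<Longrightarrow> order_weight n ks A = order_weight n ks B"
proof (induction ks arbitrary: A B)
  case Nil
  then show ?case by simp
next
  case (Cons k ks)
  have "(A - {a}) \<inter> napkins n (set ks) = (B - {a}) \<inter> napkins n (set ks)" for a
    using Cons.prems by (auto simp: napkins_def)
  moreover have "A \<inter> napkins n (set ks) = B \<inter> napkins n (set ks)"
    "A \<inter> napkins n {k} = B \<inter> napkins n {k}"
    using Cons.prems by (auto simp: napkins_def)
  ultimately show ?case
    unfolding order_weight.simps by (intro arrive_local Cons.IH)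
qed

definition mean_weight :: "nat \<Rightarrow> nat set \<Rightarrow> nat set \<Rightarrow> 'a" where
  "mean_weight n I A =
     (\<Sum>ks\<in>permutations_of_set I. order_weight n ks A) / fact (card I)"

lemma mean_weight_empty [simp]: "mean_weight n {} A = 1"
  by (simp add: mean_weight_def)

text \<open>
  The first to arrive is uniformly distributed on \<open>I\<close>, and the others then arrive in uniformly
  random order. Multiplying by \<open>card I\<close> clears the denominator of this average, so that the
  empty set needs no separate treatment.
\<close>

lemma mean_weight_first_arrival:
  assumes "finite I"
  shows "of_nat (card I) * mean_weight n I A = (\<Sum>k\<in>I. arrive n k (mean_weight n (I - {k})) A)"
proof (cases "I = {}")
  case False
  have "(\<Sum>ks\<in>permutations_of_set I. order_weight n ks A) =
        (\<Sum>k\<in>I. \<Sum>ks\<in>(#) k ` permutations_of_set (I - {k}). order_weight n ks A)"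
    unfolding permutations_of_set_nonempty[OF False]
    using assms by (intro sum.UNION_disjoint) auto
  also have "\<dots> = (\<Sum>k\<in>I. \<Sum>ks\<in>permutations_of_set (I - {k}). arrive n k (order_weight n ks) A)"
    by (rule sum.cong[OF refl]) (subst sum.reindex, auto simp: inj_on_def)
  also have "\<dots> = (\<Sum>k\<in>I. arrive n k (\<lambda>B. mean_weight n (I - {k}) B * fact (card I - 1)) A)"
    using assms by (intro sum.cong refl) (simp add: mean_weight_def flip: arrive_sum)
  also have "\<dots> = (\<Sum>k\<in>I. arrive n k (mean_weight n (I - {k})) A) * fact (card I - 1)"
    by (simp add: arrive_scale sum_distrib_right)
  finally have *: "(\<Sum>ks\<in>permutations_of_set I. order_weight n ks A) = \<dots>" .
  obtain m where m: "card I = Suc m"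
    using assms False by (cases "card I") auto
  show ?thesis
    unfolding mean_weight_def[of n I] * m by (simp add: field_simps del: of_nat_Suc)
qed simp

lemma mean_weight_local:
  assumes "A \<inter> napkins n I = B \<inter> napkins n I"
  shows "mean_weight n I A = mean_weight n I B"
  unfolding mean_weight_def
  using assms by (intro arg_cong2[where f = "(/)"] sum.cong refl order_weight_local)
    (auto dest: permutations_of_setD)

text \<open>
  Independence of two groups without a common napkin. Shuffles of two orders of arrival need not
  be counted: by induction, the first arrival of the union lies in one of the groups and leaves the
  factor of the other group unchanged, and the two resulting sums are \<open>card I\<close> and \<open>card J\<close> times
  the product.
\<close>

lemma mean_weight_Un:
  assumes "finite I" "finite J" "napkins n I \<inter> napkins n J = {}"
  shows "mean_weight n (I \<union> J) A = mean_weight n I A * mean_weight n J A"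
  using assms
proof (induction "card I + card J" arbitrary: I J A rule: less_induct)
  case less
  show ?case
  proof (cases "I = {} \<or> J = {}")
    case True
    then show ?thesis by auto
  next
    case False
    have disj: "I \<inter> J = {}"
      using less.prems by (auto simp: napkins_def)
    have pos: "card I > 0" "card J > 0"
      using False less.prems by (auto simp: card_gt_0_iff)
    have L: "arrive n k (mean_weight n (I \<union> J - {k})) A =
        arrive n k (mean_weight n (I - {k})) A * mean_weight n J A" if "k \<in> I" for k
    proof -
      have "mean_weight n (I \<union> J - {k}) B = mean_weight n (I - {k}) B * mean_weight n J A"
        if B: "B \<subseteq> A" "A - B \<subseteq> napkins n {k}" for B
      proof -
        have "I \<union> J - {k} = (I - {k}) \<union> J" using \<open>k \<in> I\<close> disj by auto
        moreover have "mean_weight n ((I - {k}) \<union> J) B = mean_weight n (I - {k}) B * mean_weight n J B"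
          using less.prems \<open>k \<in> I\<close> pos
          by (intro less.hyps) (auto simp: napkins_def)
        moreover have "mean_weight n J B = mean_weight n J A"
        proof (rule mean_weight_local)
          have "napkins n {k} \<subseteq> napkins n I"
            using \<open>k \<in> I\<close> by (auto simp: napkins_def)
          then show "B \<inter> napkins n J = A \<inter> napkins n J"
            using B less.prems(3) by blast
        qed
        ultimately show ?thesis by simp
      qed
      then have "arrive n k (mean_weight n (I \<union> J - {k})) A =
          arrive n k (\<lambda>B. mean_weight n (I - {k}) B * mean_weight n J A) A"
        by (rule arrive_cong)
      then show ?thesis by (simp add: arrive_scale)
    qed
    have R: "arrive n k (mean_weight n (I \<union> J - {k})) A =
        arrive n k (mean_weight n (J - {k})) A * mean_weight n I A" if "k \<in> J" for k
    proof -
      have "mean_weight n (I \<union> J - {k}) B = mean_weight n (J - {k}) B * mean_weight n I A"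
        if B: "B \<subseteq> A" "A - B \<subseteq> napkins n {k}" for B
      proof -
        have "I \<union> J - {k} = I \<union> (J - {k})" using \<open>k \<in> J\<close> disj by auto
        moreover have "mean_weight n (I \<union> (J - {k})) B = mean_weight n I B * mean_weight n (J - {k}) B"
          using less.prems \<open>k \<in> J\<close> pos
          by (intro less.hyps) (auto simp: napkins_def)
        moreover have "mean_weight n I B = mean_weight n I A"
        proof (rule mean_weight_local)
          have "napkins n {k} \<subseteq> napkins n J"
            using \<open>k \<in> J\<close> by (auto simp: napkins_def)
          then show "B \<inter> napkins n I = A \<inter> napkins n I"
            using B less.prems(3) by blast
        qed
        ultimately show ?thesis by simp
      qed
      then have "arrive n k (mean_weight n (I \<union> J - {k})) A =
          arrive n k (\<lambda>B. mean_weight n (J - {k}) B * mean_weight n I A) A"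
        by (rule arrive_cong)
      then show ?thesis by (simp add: arrive_scale)
    qed
    have "of_nat (card (I \<union> J)) * mean_weight n (I \<union> J) A =
        (\<Sum>k\<in>I. arrive n k (mean_weight n (I \<union> J - {k})) A)
        + (\<Sum>k\<in>J. arrive n k (mean_weight n (I \<union> J - {k})) A)"
      using less.prems disj by (simp add: mean_weight_first_arrival sum.union_disjoint)
    also have "\<dots> = (\<Sum>k\<in>I. arrive n k (mean_weight n (I - {k})) A) * mean_weight n J A
        + (\<Sum>k\<in>J. arrive n k (mean_weight n (J - {k})) A) * mean_weight n I A"
      by (simp add: L R sum_distrib_right)
    also have "\<dots> = of_nat (card (I \<union> J)) * (mean_weight n I A * mean_weight n J A)"
      using less.prems disj
      by (simp add: card_Un_disjoint algebra_simps flip: mean_weight_first_arrival)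
    finally have "of_nat (card (I \<union> J)) * mean_weight n (I \<union> J) A =
        of_nat (card (I \<union> J)) * (mean_weight n I A * mean_weight n J A)" .
    moreover have "(of_nat (card (I \<union> J)) :: 'a) \<noteq> 0"
      using False less.prems by simp
    ultimately show ?thesis by (metis mult_left_cancel)
  qed
qed

section \<open>Arcs of consecutive places\<close>

text \<open>
  The mean weight of \<open>m\<close> consecutive places, where \<open>l\<close> and \<open>r\<close> tell whether the leftmost and the
  rightmost napkin are available, while all napkins between the places are. The index \<open>j\<close> counts the
  places to the left of the first arrival. The preferred napkin can only be missing at an end of the
  arc; the guest then takes the other one, and only for a single place can that be missing as well.
  An empty arc has weight \<open>1\<close> for all four values of \<open>l\<close> and \<open>r\<close>, so the flags of an empty part
  do not matter.
\<close>

function segment :: "bool \<Rightarrow> bool \<Rightarrow> nat \<Rightarrow> 'a" where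
  "segment l r 0 = 1"
| "segment l r (Suc m) = (\<Sum>j\<le>m.
     p * (if 0 < j \<or> l then segment l False j * segment True r (m - j)
          else if j < m \<or> r then y * segment False r m else x)
     + q * (if j < m \<or> r then segment l True j * segment False r (m - j)
            else if 0 < j \<or> l then y * segment l False m else x)) / of_nat (Suc m)"
  by pat_completeness auto
termination by (relation "Wellfounded.measure (\<lambda>(l, r, m). m)") auto

declare segment.simps(2) [simp del]

text \<open>
  Place \<open>c i\<close> has the napkins \<open>c i\<close> and \<open>c (Suc i)\<close>. Only injectivity on the napkins within reach is
  demanded, so \<open>c\<close> may run around the circular table, past place \<open>n\<close>.
\<close>

lemma mean_weight_arc:
  assumes "inj_on c {a..a + m}" and "\<And>i. right_napkin n (c i) = c (Suc i)"
    and "c ` {a<..<a + m} \<subseteq> A"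
  shows "mean_weight n (c ` {a..<a + m}) A = segment (c a \<in> A) (c (a + m) \<in> A) m"
  using assms(1,3)
proof (induction m arbitrary: a A rule: less_induct)
  case (less m)
  show ?case
  proof (cases m)
    case (Suc m')
    define I where "I = c ` {a..<a + m}"
    have inj: "inj_on c {a..a + Suc m'}"
      using less.prems Suc by simp
    have card: "card I = Suc m'"
      unfolding I_def using Suc by (subst card_image) (auto intro: inj_on_subset[OF inj])
    have ceq: "c i = c j \<longleftrightarrow> i = j" if "i \<in> {a..a + Suc m'}" "j \<in> {a..a + Suc m'}" for i j
      using inj that by (auto simp: inj_on_def)
    define l r where "l = (c a \<in> A)" and "r = (c (a + Suc m') \<in> A)"
    have first: "arrive n (c (a + j)) (mean_weight n (I - {c (a + j)})) A =
        p * (if 0 < j \<or> l then segment l False j * segment True r (m' - j)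
             else if j < m' \<or> r then y * segment False r m' else x)
        + q * (if j < m' \<or> r then segment l True j * segment False r (m' - j)
               else if 0 < j \<or> l then y * segment l False m' else x)" if "j \<le> m'" for j
    proof -
      let ?k = "c (a + j)" and ?s = "c (Suc (a + j))"
      have split: "I - {?k} = c ` {a..<a + j} \<union> c ` {Suc (a + j)..<Suc (a + j) + (m' - j)}"
      proof -
        have "{a..<a + m} = insert (a + j) ({a..<a + j} \<union> {Suc (a + j)..<Suc (a + j) + (m' - j)})"
          using that Suc by auto
        then show ?thesis
          unfolding I_def using that by (auto simp: ceq)
      qed
      \<comment> \<open>The two sides of place \<open>a + j\<close> never share a napkin, whichever napkin its guest takes.\<close>
      have mean: "mean_weight n (I - {?k}) B =
          segment (c a \<in> B) (?k \<in> B) j * segment (?s \<in> B) (c (a + Suc m') \<in> B) (m' - j)"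
        if B: "A - {?k, ?s} \<subseteq> B" for B
      proof -
        have interior: "c i \<in> B" if "i \<in> {a<..<a + m}" "i \<noteq> a + j" "i \<noteq> Suc (a + j)" for i
        proof -
          have "c i \<noteq> ?k" "c i \<noteq> ?s"
            using that \<open>j \<le> m'\<close> Suc by (simp_all add: ceq)
          moreover have "c i \<in> A"
            using less.prems(2) that(1) by blast
          ultimately show ?thesis using B by blast
        qed
        have left: "mean_weight n (c ` {a..<a + j}) B = segment (c a \<in> B) (?k \<in> B) j"
        proof (rule less.IH)
          show "inj_on c {a..a + j}" by (rule inj_on_subset[OF inj]) (use \<open>j \<le> m'\<close> in auto)
          show "c ` {a<..<a + j} \<subseteq> B"
            using \<open>j \<le> m'\<close> Suc by (intro image_subsetI interior) auto
        qed (use \<open>j \<le> m'\<close> Suc in auto)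
        have right: "mean_weight n (c ` {Suc (a + j)..<Suc (a + j) + (m' - j)}) B =
            segment (?s \<in> B) (c (Suc (a + j) + (m' - j)) \<in> B) (m' - j)"
        proof (rule less.IH)
          show "inj_on c {Suc (a + j)..Suc (a + j) + (m' - j)}"
            by (rule inj_on_subset[OF inj]) (use \<open>j \<le> m'\<close> in auto)
          show "c ` {Suc (a + j)<..<Suc (a + j) + (m' - j)} \<subseteq> B"
            using \<open>j \<le> m'\<close> Suc by (intro image_subsetI interior) auto
        qed (use \<open>j \<le> m'\<close> Suc in auto)
        have "napkins n (c ` {a..<a + j}) \<inter>
            napkins n (c ` {Suc (a + j)..<Suc (a + j) + (m' - j)}) = {}"
          using \<open>j \<le> m'\<close> by (auto simp: napkins_def left_napkin_def assms(2) ceq)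
        then show ?thesis
          unfolding split using left right \<open>j \<le> m'\<close> by (simp add: mean_weight_Un)
      qed
      have k_in: "?k \<in> A \<longleftrightarrow> 0 < j \<or> l"
        using less.prems(2) Suc that unfolding l_def r_def by (cases "j = 0") auto
      have s_in: "?s \<in> A \<longleftrightarrow> j < m' \<or> r"
        using less.prems(2) Suc that unfolding l_def r_def by (cases "j = m'") auto
      have "c a = ?k \<longleftrightarrow> j = 0" "c (a + Suc m') = ?s \<longleftrightarrow> j = m'" "c a \<noteq> ?s"
        "c (a + Suc m') \<noteq> ?k" "?k \<noteq> ?s"
        using that by (auto simp: ceq)
      moreover have "A - {?k, ?s} \<subseteq> A - {?k}" "A - {?k, ?s} \<subseteq> A - {?s}" "A - {?k, ?s} \<subseteq> A"
        by auto
      note this[THEN mean]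
      ultimately show ?thesis
        unfolding arrive_def settle_def left_napkin_def assms(2)
        using k_in s_in that unfolding l_def r_def
        by (cases "j = 0"; cases "j = m'") simp_all
    qed
    have "of_nat (Suc m') * mean_weight n I A =
        (\<Sum>k\<in>I. arrive n k (mean_weight n (I - {k})) A)"
      using mean_weight_first_arrival[of I n A] card by (simp add: I_def)
    also have "\<dots> = (\<Sum>j\<le>m'. arrive n (c (a + j)) (mean_weight n (I - {c (a + j)})) A)"
    proof -
      have "I = (\<lambda>j. c (a + j)) ` {..m'}"
        unfolding I_def using Suc
        by (auto simp: image_iff) (metis atMost_iff le_add_diff_inverse less_Suc_eq_le nat_add_left_cancel_le)
      moreover have "inj_on (\<lambda>j. c (a + j)) {..m'}"
        by (auto simp: inj_on_def ceq)
      ultimately show ?thesis by (simp add: sum.reindex)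
    qed
    also have "\<dots> = of_nat (Suc m') * segment l r (Suc m')"
      using first by (simp add: segment.simps(2) del: of_nat_Suc)
    finally show ?thesis
      using Suc by (simp add: I_def l_def r_def del: of_nat_Suc)
  qed simp
qed

text \<open>
  All \<open>n\<close> choices of the first place contribute equally. Read counter-clockwise from the first guest,
  the remaining places form an arc that begins with his right napkin and ends with his left one, so
  taking the left napkin closes the right end of the arc and vice versa.
\<close>

lemma mean_weight_circle:
  assumes "n \<ge> 1"
  shows "mean_weight n {1..n} {1..n} = p * segment True False (n - 1) + q * segment False True (n - 1)"
proof -
  define c where "c i = i mod n + 1" for i
  have right: "right_napkin n (c i) = c (Suc i)" for i
    using assms by (auto simp: c_def right_napkin_def mod_Suc)
  have inj: "inj_on c {a..a + (n - 1)}" for a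
  proof (rule inj_onI)
    fix i j assume *: "i \<in> {a..a + (n - 1)}" "j \<in> {a..a + (n - 1)}" "c i = c j"
    have "i = j" if "i \<le> j" "i \<in> {a..a + (n - 1)}" "j \<in> {a..a + (n - 1)}" "i mod n = j mod n" for i j
    proof -
      have "n dvd j - i" using that by (metis mod_eq_dvd_iff_nat)
      moreover have "j - i < n" using that assms by auto
      ultimately show ?thesis using that(1) by (auto dest: dvd_imp_le)
    qed
    from this[of i j] this[of j i] * show "i = j"
      by (cases i j rule: linorder_le_cases) (auto simp: c_def)
  qed
  have range: "c i \<in> {1..n}" for i
    using assms by (auto simp: c_def Suc_le_eq)
  have full: "c ` {a..a + (n - 1)} = {1..n}" for a
    using range inj assms by (intro card_subset_eq) (auto simp: card_image)
  have arrive: "arrive n k (mean_weight n ({1..n} - {k})) {1..n} =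
      p * segment True False (n - 1) + q * segment False True (n - 1)" if k: "k \<in> {1..n}" for k
  proof -
    have ca: "c (k - 1) = k" "c (k + (n - 1)) = k"
    proof -
      show "c (k - 1) = k" using k by (auto simp: c_def)
      have "k + (n - 1) = (k - 1) + n" using k by auto
      then have "c (k + (n - 1)) = c (k - 1)" by (simp add: c_def)
      with \<open>c (k - 1) = k\<close> show "c (k + (n - 1)) = k" by simp
    qed
    have right_k: "right_napkin n k = c k"
      using right[of "k - 1"] ca k by simp
    have "{1..n} = insert k (c ` {k..<k + (n - 1)})"
    proof -
      have "{k..k + (n - 1)} = insert (k + (n - 1)) {k..<k + (n - 1)}" by auto
      then show ?thesis using full[of k] ca(2) by (metis image_insert)
    qed
    moreover have ceq: "c i = c j \<longleftrightarrow> i = j" if "i \<in> {k..k + (n - 1)}" "j \<in> {k..k + (n - 1)}" for i j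
      using that by (rule inj_on_eq_iff[OF inj])
    have not_k: "c i \<noteq> k" if "i \<in> {k..<k + (n - 1)}" for i
      using ceq[of i "k + (n - 1)"] ca(2) that by simp
    ultimately have arc: "{1..n} - {k} = c ` {k..<k + (n - 1)}" by blast
    have interior: "c i \<noteq> k \<and> c i \<noteq> c k" if "i \<in> {k<..<k + (n - 1)}" for i
      using ceq[of i k] not_k[of i] that by simp
    \<comment> \<open>For \<open>n = 1\<close> the two napkins coincide; the arc is then empty, so its flags do not matter.\<close>
    have ck: "c k = k \<longleftrightarrow> n = 1"
      using ceq[of k "k + (n - 1)"] ca(2) assms by auto
    have mean: "mean_weight n ({1..n} - {k}) B = segment (c k \<in> B) (k \<in> B) (n - 1)"
      if "{1..n} - {k, c k} \<subseteq> B" for B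
    proof -
      have "c ` {k<..<k + (n - 1)} \<subseteq> B"
      proof (rule image_subsetI)
        fix i assume "i \<in> {k<..<k + (n - 1)}"
        then show "c i \<in> B" using interior range[of i] that by blast
      qed
      from mean_weight_arc[OF inj right this] show ?thesis
        by (simp only: arc ca)
    qed
    have "mean_weight n ({1..n} - {k}) ({1..n} - {k}) = segment (c k \<noteq> k) False (n - 1)"
      using range[of k] by (subst mean) auto
    moreover have "mean_weight n ({1..n} - {k}) ({1..n} - {c k}) = segment False (c k \<noteq> k) (n - 1)"
      using k by (subst mean) (auto simp: eq_commute[of k "c k"])
    moreover have "segment (c k \<noteq> k) False (n - 1) = segment True False (n - 1)"
      "segment False (c k \<noteq> k) (n - 1) = segment False True (n - 1)"
      using ck by (cases "n = 1"; simp)+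
    ultimately show ?thesis
      using k range[of k] by (simp add: arrive_def settle_def left_napkin_def right_k)
  qed
  have "of_nat n * mean_weight n {1..n} {1..n} =
      (\<Sum>k\<in>{1..n}. arrive n k (mean_weight n ({1..n} - {k})) {1..n})"
    using mean_weight_first_arrival[of "{1..n}" n "{1..n}"] by simp
  also have "\<dots> = (\<Sum>k\<in>{1..n}. p * segment True False (n - 1) + q * segment False True (n - 1))"
    by (rule sum.cong[OF refl arrive])
  also have "\<dots> = of_nat n * (p * segment True False (n - 1) + q * segment False True (n - 1))"
    by simp
  finally show ?thesis using assms by simp
qed

section \<open>Differential equations\<close>

definition segment_gf :: "bool \<Rightarrow> bool \<Rightarrow> 'a fps" where
  "segment_gf l r = Abs_fps (segment l r)"

lemma segment_Suc:
  "of_nat (Suc m) * segment l r (Suc m) = (\<Sum>j\<le>m.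
     p * (if 0 < j \<or> l then segment l False j * segment True r (m - j)
          else if j < m \<or> r then y * segment False r m else x)
     + q * (if j < m \<or> r then segment l True j * segment False r (m - j)
            else if 0 < j \<or> l then y * segment l False m else x))"
  by (simp add: segment.simps(2) del: of_nat_Suc)

text \<open>
  An arc with one napkin fewer than places needs at least one place. Subtracting \<open>1\<close> removes the
  empty arc, and the convolutions below then skip exactly those positions of the first arrival
  that the recursion treats separately.
\<close>

abbreviation "open_both \<equiv> segment_gf True True"
abbreviation "open_left \<equiv> segment_gf True False"
abbreviation "open_right \<equiv> segment_gf False True"
abbreviation "open_none \<equiv> segment_gf False False - 1"

lemma segment_gf_nth [simp]: "segment_gf l r $ m = segment l r m"
  by (simp add: segment_gf_def)

lemma segment_gf_mult_nth: "(segment_gf l r * F) $ m = (\<Sum>j\<le>m. segment l r j * F $ (m - j))"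
  by (simp add: fps_mult_nth atLeast0AtMost)

lemma open_none_mult_nth: "(open_none * F) $ m = (\<Sum>j\<le>m. open_none $ j * F $ (m - j))"
  by (simp add: fps_mult_nth atLeast0AtMost)

lemma deriv_segment_gf_nth: "fps_deriv (segment_gf l r) $ m = of_nat (Suc m) * segment l r (Suc m)"
  by (simp add: segment_gf_def)

lemma open_none_nth: "open_none $ m = (if m = 0 then 0 else segment False False m)"
  by (simp add: segment_gf_def)

lemma deriv_open_both:
  "fps_deriv open_both = (fps_const p * open_left + fps_const q * open_right) * open_both"
proof (rule fps_ext)
  fix m
  have "fps_deriv open_both $ m =
      (fps_const p * (open_left * open_both) + fps_const q * (open_both * open_right)) $ m"
    unfolding deriv_segment_gf_nth segment_Suc
    by (simp add: segment_gf_mult_nth open_none_mult_nth sum.distrib sum_distrib_left)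
  then show "fps_deriv open_both $ m =
      ((fps_const p * open_left + fps_const q * open_right) * open_both) $ m"
    by (simp add: algebra_simps)
qed

lemma deriv_open_left:
  "fps_deriv open_left =
     fps_const p * (open_left * open_left) + fps_const q * (open_both * open_none)
     + fps_const (q * y) * open_left"
proof (rule fps_ext)
  fix m
  have "fps_deriv open_left $ m = (\<Sum>j\<le>m. p * (segment True False j * segment True False (m - j)) +
      q * (segment True True j * open_none $ (m - j)) + (if j = m then q * y * segment True False m else 0))"
    unfolding deriv_segment_gf_nth segment_Suc by (intro sum.cong refl) (auto simp: open_none_nth)
  then show "fps_deriv open_left $ m =
      (fps_const p * (open_left * open_left) + fps_const q * (open_both * open_none)
       + fps_const (q * y) * open_left) $ m"
    by (simp add: segment_gf_mult_nth open_none_mult_nth sum.distrib sum_distrib_left)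
qed

lemma deriv_open_right:
  "fps_deriv open_right =
     fps_const q * (open_right * open_right) + fps_const p * (open_none * open_both)
     + fps_const (p * y) * open_right"
proof (rule fps_ext)
  fix m
  have "fps_deriv open_right $ m = (\<Sum>j\<le>m. q * (segment False True j * segment False True (m - j)) +
      p * (open_none $ j * segment True True (m - j)) + (if j = 0 then p * y * segment False True m else 0))"
    unfolding deriv_segment_gf_nth segment_Suc by (intro sum.cong refl) (auto simp: open_none_nth)
  then show "fps_deriv open_right $ m =
      (fps_const q * (open_right * open_right) + fps_const p * (open_none * open_both)
       + fps_const (p * y) * open_right) $ m"
    by (simp add: segment_gf_mult_nth open_none_mult_nth sum.distrib sum_distrib_left)
qed

lemma deriv_open_none:
  "fps_deriv open_none =
     fps_const x + (fps_const p * open_left + fps_const q * open_right + fps_const y) * open_none"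
proof (rule fps_ext)
  fix m
  have "fps_deriv open_none $ m = (\<Sum>j\<le>m. p * (open_none $ j * segment True False (m - j)) +
      q * (segment False True j * open_none $ (m - j)) +
      (if j = 0 then p * (if m = 0 then x else y * open_none $ m) else 0) +
      (if j = m then q * (if m = 0 then x else y * open_none $ m) else 0))"
    unfolding fps_deriv_sub fps_sub_nth[of "fps_deriv (segment_gf False False)"]
      deriv_segment_gf_nth segment_Suc fps_deriv_1 fps_zero_nth diff_zero
    by (intro sum.cong refl) (auto simp: open_none_nth)
  also have "\<dots> = (\<Sum>j\<le>m. p * (open_none $ j * segment True False (m - j)) +
      q * (segment False True j * open_none $ (m - j))) + (p + q) * (if m = 0 then x else y * open_none $ m)"
    by (simp add: sum.distrib distrib_right add.assoc del: fps_sub_nth)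
  also have "\<dots> = (fps_const p * (open_none * open_left) + fps_const q * (open_right * open_none)) $ m
      + (fps_const x + fps_const y * open_none) $ m"
    unfolding p_plus_q
    by (simp add: segment_gf_mult_nth open_none_mult_nth sum.distrib sum_distrib_left)
  finally show "fps_deriv open_none $ m =
      (fps_const x + (fps_const p * open_left + fps_const q * open_right + fps_const y) * open_none) $ m"
    by (simp add: algebra_simps)
qed

text \<open>
  The denominator \<open>D\<close>, and the numerator without its factor \<open>z\<close>.
\<close>

definition denominator :: "'a fps" where
  "denominator = (let P = fps_const p; Q = fps_const q; X = fps_const x; Y = fps_const y in
     P * Q * (Y - X) * fps_exp y
     + (Q * X - P * Q * Y - Q^2 * Y^2) * fps_exp (p * y)
     + (P * X - P * Q * Y - P^2 * Y^2) * fps_exp (q * y)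
     + P * Q * (Y * (Y - 1)^2 + X * (1 - Y * fps_X)) + Y^2 - X)"

definition numerator :: "'a fps" where
  "numerator = (let P = fps_const p; Q = fps_const q; X = fps_const x; Y = fps_const y in
     P * Q * Y *
     ((X - Y) * fps_exp y + (Q * Y^2 + P * Y - X) * fps_exp (p * y)
      + (P * Y^2 + Q * Y - X) * fps_exp (q * y) + X))"

text \<open>
  Once the denominator is known to be a multiple of \<open>1/B\<close>, this says that \<open>numerator/denominator\<close>
  is the logarithmic derivative of \<open>B\<close>, which is \<open>p L + q R\<close>.
\<close>

lemma deriv_denominator: "fps_deriv denominator = - numerator"
proof -
  define P Q X Y where "P = fps_const p" "Q = fps_const q" "X = fps_const x" "Y = fps_const y"
  have d_const: "fps_deriv P = 0" "fps_deriv Q = 0" "fps_deriv X = 0" "fps_deriv Y = 0"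
    by (simp_all add: P_Q_X_Y_def)
  have d_exp: "fps_deriv (fps_exp y) = Y * fps_exp y"
    "fps_deriv (fps_exp (p * y)) = P * Y * fps_exp (p * y)"
    "fps_deriv (fps_exp (q * y)) = Q * Y * fps_exp (q * y)"
    by (simp_all add: P_Q_X_Y_def)
  show ?thesis
    unfolding denominator_def numerator_def Let_def P_Q_X_Y_def[symmetric]
    by (simp add: power2_eq_square d_const d_exp del: fps_exp_deriv) (simp add: algebra_simps)
qed

lemma denominator_nth_0: "denominator $ 0 = p * q * y ^ 3"
proof -
  have q: "q = 1 - p" using p_plus_q by (simp add: eq_diff_eq add.commute)
  show ?thesis
    unfolding denominator_def Let_def
    by (simp add: power2_eq_square power3_eq_cube) (simp add: q algebra_simps)
qed

text \<open>
  The substitution by \<open>U\<close>, \<open>M\<close>, \<open>K\<close>, \<open>E\<close> linearises the system. The equations for \<open>E\<close>, \<open>M\<close>, \<open>K\<close> are solved by exhibiting a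
  combination of the unknowns whose derivative is a constant multiple of itself, which avoids
  dividing by \<open>p\<close>, \<open>q\<close> or \<open>y\<close>.
\<close>

lemma denominator_mult_segment_gf:
  "denominator * (fps_const p * open_left + fps_const q * open_right) = numerator"
proof -
  let ?B = open_both and ?L = open_left and ?R = open_right and ?N = open_none
  define P Q X Y where "P = fps_const p" "Q = fps_const q" "X = fps_const x" "Y = fps_const y"
  have "P + Q = 1" by (simp add: P_Q_X_Y_def(1,2) p_plus_q)
  then have PQ: "Q = 1 - P" by (simp add: eq_diff_eq add.commute)
  have d_const: "fps_deriv P = 0" "fps_deriv Q = 0" "fps_deriv X = 0" "fps_deriv Y = 0"
    by (simp_all add: P_Q_X_Y_def)
  define U where "U = inverse ?B"
  have UB: "U * ?B = 1" "?B * U = 1"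
    by (simp_all add: U_def inverse_mult_eq_1 inverse_mult_eq_1')
  define M K E where "M = ?L * U" and "K = ?R * U" and "E = ?L * ?R * U - ?N"
  have dB: "fps_deriv ?B = (P * ?L + Q * ?R) * ?B"
    using deriv_open_both by (simp add: P_Q_X_Y_def)
  have dL: "fps_deriv ?L = P * ?L * ?L + Q * ?B * ?N + Q * Y * ?L"
    using deriv_open_left by (simp add: P_Q_X_Y_def)
  have dR: "fps_deriv ?R = Q * ?R * ?R + P * ?N * ?B + P * Y * ?R"
    using deriv_open_right by (simp add: P_Q_X_Y_def)
  have dN: "fps_deriv ?N = X + (P * ?L + Q * ?R + Y) * ?N"
    using deriv_open_none by (simp add: P_Q_X_Y_def)
  have dU: "fps_deriv U = - (P * M + Q * K)"
  proof -
    have "fps_deriv U = - fps_deriv ?B * U ^ 2"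
      unfolding U_def by (rule fps_inverse_deriv) simp
    also have "\<dots> = - (P * ?L + Q * ?R) * U * (U * ?B)"
      unfolding dB by (simp add: power2_eq_square algebra_simps)
    finally show ?thesis
      unfolding UB by (simp add: M_def K_def algebra_simps)
  qed
  have dM: "fps_deriv M = Q * Y * M - Q * E"
  proof -
    have "fps_deriv M =
        (P * ?L * ?L + Q * Y * ?L) * U + Q * ?N * (?B * U) - ?L * (P * M + Q * K)"
      unfolding M_def fps_deriv_mult dL dU by (simp add: algebra_simps M_def)
    then show ?thesis
      unfolding UB by (simp add: algebra_simps M_def K_def E_def)
  qed
  have dK: "fps_deriv K = P * Y * K - P * E"
  proof -
    have "fps_deriv K =
        (Q * ?R * ?R + P * Y * ?R) * U + P * ?N * (?B * U) - ?R * (P * M + Q * K)"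
      unfolding K_def fps_deriv_mult dR dU by (simp add: algebra_simps K_def)
    then show ?thesis
      unfolding UB by (simp add: algebra_simps M_def K_def E_def)
  qed
  have dE: "fps_deriv E = Y * E - X"
  proof -
    have E: "E = M * ?R - ?N" by (simp add: E_def M_def mult_ac)
    have "fps_deriv E = (Q * Y * M - Q * E) * ?R
        + M * (Q * ?R * ?R + P * Y * ?R) + P * ?L * ?N * (U * ?B)
        - (X + (P * ?L + Q * ?R + Y) * ?N)"
      unfolding E fps_deriv_sub[of "M * ?R"] fps_deriv_mult dM dR dN by (simp add: algebra_simps E M_def)
    also have "\<dots> = (P + Q) * Y * M * ?R - Y * ?N - X + Q * ?R * (M * ?R - ?N - E)"
      unfolding UB by (simp add: algebra_simps)
    finally show ?thesis
      unfolding E PQ by (simp add: algebra_simps)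
  qed
  have E0: "E $ 0 = 1" "M $ 0 = 1" "K $ 0 = 1" "U $ 0 = 1"
    by (simp_all add: E_def M_def K_def U_def)
  note cs = P_Q_X_Y_def
  have exp_unique: "F = fps_const (F $ 0) * fps_exp c" if "fps_deriv F = fps_const c * F" for F and c :: 'a
    using that by (simp only: fps_exp_unique_ODE)
  \<comment> \<open>Eigenfunctions of the linear system for the rates \<open>y\<close>, \<open>q y\<close> and \<open>p y\<close>.\<close>
  define Z where "Z = Y * E - X"
  have Z: "Z = fps_const (y - x) * fps_exp y"
  proof -
    have "fps_deriv Z = fps_const y * Z"
      by (simp add: Z_def dE d_const) (simp add: cs)
    moreover have "Z $ 0 = y - x" by (simp add: Z_def E0 cs)
    ultimately show ?thesis using exp_unique by metis
  qed
  have V: "P * Y^2 * M + Q * Y * E - X = fps_const (p * y^2 + q * y - x) * fps_exp (q * y)"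
    (is "?V = _")
  proof -
    have "fps_deriv ?V = Q * Y * ?V"
      by (simp add: dE dM d_const power2_eq_square) (simp add: PQ algebra_simps)
    then have "fps_deriv ?V = fps_const (q * y) * ?V"  by (simp add: cs)
    moreover have "?V $ 0 = p * y^2 + q * y - x" by (simp add: E0 cs power2_eq_square)
    ultimately show ?thesis using exp_unique by metis
  qed
  have W: "Q * Y^2 * K + P * Y * E - X = fps_const (q * y^2 + p * y - x) * fps_exp (p * y)"
    (is "?W = _")
  proof -
    have "fps_deriv ?W = P * Y * ?W"
      by (simp add: dE dK d_const power2_eq_square) (simp add: PQ algebra_simps)
    then have "fps_deriv ?W = fps_const (p * y) * ?W"  by (simp add: cs)
    moreover have "?W $ 0 = q * y^2 + p * y - x" by (simp add: E0 cs power2_eq_square)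
    ultimately show ?thesis using exp_unique by metis
  qed
  \<comment> \<open>In this combination of the three eigenfunctions \<open>E\<close> cancels, because \<open>P + Q = 1\<close>.\<close>
  have "numerator = P * Q * Y * (?V + ?W - Z + X)"
    unfolding numerator_def Let_def V W Z
    by (simp add: cs algebra_simps power2_eq_square flip: fps_const_sub fps_const_add fps_const_mult)
  also have "\<dots> = P * Q * Y^3 * (P * M + Q * K)"
    by (simp add: Z_def PQ power2_eq_square power3_eq_cube algebra_simps)
  finally have N: "numerator = P * Q * Y^3 * (P * M + Q * K)" .
  have "fps_deriv denominator = fps_deriv (P * Q * Y^3 * U)"
    unfolding deriv_denominator N by (simp add: d_const dU power3_eq_cube algebra_simps)
  moreover have "(P * Q * Y^3 * U) $ 0 = denominator $ 0"
    by (simp add: denominator_nth_0 E0 cs power3_eq_cube)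
  ultimately have "denominator = P * Q * Y^3 * U"
    unfolding fps_deriv_eq_iff by simp
  then show ?thesis
    unfolding N by (simp add: cs M_def K_def algebra_simps)
qed

end

section \<open>Outcomes of a seating and their probabilities\<close>

lemma seating_cong:
  "(\<And>k. k \<in> set ks \<Longrightarrow> f k = g k) \<Longrightarrow> seating n f A ks = seating n g A ks"
  by (induction ks arbitrary: A) (simp_all add: preferred_napkin_def other_napkin_def Let_def)

context napkin_weights
begin

text \<open>
  The set \<open>L\<close> collects the guests who prefer the left napkin.
\<close>

definition outcome_weight :: "nat \<Rightarrow> nat list \<Rightarrow> nat set \<Rightarrow> nat set \<Rightarrow> 'a" where
  "outcome_weight n ks L A =
     p ^ card L * q ^ card (set ks - L)
     * x ^ count_list (seating n (\<lambda>k. k \<in> L) A ks) Napkinless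
     * y ^ count_list (seating n (\<lambda>k. k \<in> L) A ks) Frustrated"

text \<open>
  In \<open>order_weight\<close> each guest decides on arrival; here all preferences are fixed
  beforehand. The two agree because every guest arrives only once.
\<close>

lemma order_weight_eq_sum:
  assumes "distinct ks"
  shows "order_weight n ks A = (\<Sum>L\<in>Pow (set ks). outcome_weight n ks L A)"
  using assms
proof (induction ks arbitrary: A)
  case Nil
  then show ?case by (simp add: outcome_weight_def)
next
  case (Cons k ks)
  then have k: "k \<notin> set ks" by simp
  have right: "outcome_weight n (k # ks) L A =
      q * settle (right_napkin n k) (left_napkin k) (outcome_weight n ks L) A"
    if "L \<in> Pow (set ks)" for L
  proof -
    have "k \<notin> L" "set (k # ks) - L = insert k (set ks - L)"
      using that k by auto
    then show ?thesis
      using k by (simp add: outcome_weight_def settle_def preferred_napkin_def other_napkin_def Let_def)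
  qed
  have left: "outcome_weight n (k # ks) (insert k L) A =
      p * settle (left_napkin k) (right_napkin n k) (outcome_weight n ks L) A"
    if "L \<in> Pow (set ks)" for L
  proof -
    have "k \<notin> L" "finite L" "set (k # ks) - insert k L = set ks - L"
      using that k by (auto intro: finite_subset)
    moreover have "seating n (\<lambda>i. i \<in> insert k L) B ks = seating n (\<lambda>i. i \<in> L) B ks" for B
      using k by (intro seating_cong) auto
    then have "seating n (\<lambda>i. i = k \<or> i \<in> L) B ks = seating n (\<lambda>i. i \<in> L) B ks" for B
      by simp
    ultimately show ?thesis
      by (simp add: outcome_weight_def settle_def preferred_napkin_def other_napkin_def Let_def)
  qed
  have "order_weight n (k # ks) A = (\<Sum>L\<in>Pow (set ks). arrive n k (outcome_weight n ks L) A)"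
    using Cons by (simp add: arrive_sum fun_eq_iff cong: arrive_cong)
  also have "\<dots> = (\<Sum>L\<in>Pow (set ks). outcome_weight n (k # ks) L A)
      + (\<Sum>L\<in>Pow (set ks). outcome_weight n (k # ks) (insert k L) A)"
    by (simp add: left right arrive_def sum.distrib add.commute)
  also have "\<dots> = (\<Sum>L\<in>Pow (set (k # ks)). outcome_weight n (k # ks) L A)"
  proof -
    have "inj_on (insert k) (Pow (set ks))"
      using k by (fastforce simp: inj_on_def)
    then show ?thesis
      unfolding list.set Pow_insert using k
      by (subst sum.union_disjoint) (auto simp: sum.reindex)
  qed
  finally show ?case .
qed

end

lemma pr_eq_sum:
  assumes "0 \<le> p" "p \<le> 1"
  shows "pr p i j n = (\<Sum>ks\<in>permutations_of_set {1..n}. \<Sum>L\<in>Pow {1..n}.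
    if count_list (seating n (\<lambda>k. k \<in> L) {1..n} ks) Napkinless = i \<and>
       count_list (seating n (\<lambda>k. k \<in> L) {1..n} ks) Frustrated = j
    then p ^ card L * (1 - p) ^ card ({1..n} - L) / fact n else 0)"
proof -
  let ?pref = "\<lambda>L k. k \<in> (L :: nat set)"
  let ?event = "{(order, prefers_left).
      count_list (seating n prefers_left {1..n} order) Napkinless = i \<and>
      count_list (seating n prefers_left {1..n} order) Frustrated = j}"
  define S where "S = permutations_of_set {1..n} \<times> (?pref ` Pow {1..n})"
  have fin: "finite S" by (simp add: S_def)
  have outside: "pmf (table_pmf p n) s = 0" if "s \<notin> S" for s
  proof -
    obtain ks f where s: "s = (ks, f)" by (cases s)
    have "\<exists>k. k \<notin> {1..n} \<and> f k \<noteq> False" if "f \<notin> ?pref ` Pow {1..n}"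
    proof (rule ccontr)
      assume "\<not> ?thesis"
      then have "f = ?pref {k. f k}" "{k. f k} \<subseteq> {1..n}" by auto
      with that show False by blast
    qed
    with that show ?thesis
      by (auto simp: s S_def table_pmf_def pmf_pair pmf_Pi_outside)
  qed
  have inside: "pmf (table_pmf p n) (ks, ?pref L) = p ^ card L * (1 - p) ^ card ({1..n} - L) / fact n"
    if "ks \<in> permutations_of_set {1..n}" "L \<in> Pow {1..n}" for ks L
  proof -
    have "(\<Prod>k\<in>{1..n}. pmf (bernoulli_pmf p) (k \<in> L)) =
        (\<Prod>k\<in>{1..n}. if k \<in> L then p else 1 - p)"
      using assms by (intro prod.cong) auto
    also have "\<dots> = p ^ card ({1..n} \<inter> L) * (1 - p) ^ card ({1..n} - L)"
      by (simp add: prod.If_cases Diff_eq)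
    also have "{1..n} \<inter> L = L" using that by auto
    finally have "pmf (Pi_pmf {1..n} False (\<lambda>_. bernoulli_pmf p)) (?pref L) =
        p ^ card L * (1 - p) ^ card ({1..n} - L)"
      using that by (subst pmf_Pi') auto
    then show ?thesis
      using that by (simp add: table_pmf_def pmf_pair)
  qed
  have "pr p i j n = measure_pmf.prob (table_pmf p n) (S \<inter> ?event)"
    unfolding pr_def by (intro measure_prob_cong_0) (auto simp: outside)
  also have "\<dots> = (\<Sum>s\<in>S. if s \<in> ?event then pmf (table_pmf p n) s else 0)"
    using fin by (subst measure_measure_pmf_finite) (simp_all add: sum.inter_restrict)
  also have "\<dots> = (\<Sum>ks\<in>permutations_of_set {1..n}. \<Sum>f\<in>?pref ` Pow {1..n}.
      if (ks, f) \<in> ?event then pmf (table_pmf p n) (ks, f) else 0)"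
    unfolding S_def sum.cartesian_product
    by (intro sum.cong refl) (simp add: case_prod_beta)
  also have "\<dots> = (\<Sum>ks\<in>permutations_of_set {1..n}. \<Sum>L\<in>Pow {1..n}.
      if (ks, ?pref L) \<in> ?event then pmf (table_pmf p n) (ks, ?pref L) else 0)"
  proof -
    have "inj_on ?pref (Pow {1..n})" by (auto simp: inj_on_def fun_eq_iff)
    then show ?thesis by (simp add: sum.reindex)
  qed
  also have "\<dots> = (\<Sum>ks\<in>permutations_of_set {1..n}. \<Sum>L\<in>Pow {1..n}.
      if (ks, ?pref L) \<in> ?event then p ^ card L * (1 - p) ^ card ({1..n} - L) / fact n else 0)"
    by (intro sum.cong refl) (simp add: inside del: Pow_iff)
  finally show ?thesis by simp
qed

section \<open>Passage to rational functions\<close>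

lemma ratfun_const_1 [simp]: "ratfun_const 1 = 1"
  by (simp add: ratfun_const_def flip: one_pCons)

lemma ratfun_const_add: "ratfun_const (a + b) = ratfun_const a + ratfun_const b"
  by (simp add: ratfun_const_def flip: to_fract_add)

lemma ratfun_const_mult: "ratfun_const (a * b) = ratfun_const a * ratfun_const b"
  by (simp add: ratfun_const_def flip: to_fract_mult)

lemma ratfun_const_eq_0_iff [simp]: "ratfun_const a = 0 \<longleftrightarrow> a = 0"
  by (simp add: ratfun_const_def)

lemma ratfun_const_power: "ratfun_const (a ^ n) = ratfun_const a ^ n"
  by (induction n) (simp_all add: ratfun_const_mult)

lemma ratfun_const_of_nat: "ratfun_const (of_nat n) = of_nat n"
  by (induction n) (simp_all add: ratfun_const_add)

lemma ratfun_const_divide_fact: "ratfun_const (a / fact n) = ratfun_const a / fact n"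
proof -
  have "ratfun_const (a / fact n) * ratfun_const (of_nat (fact n)) = ratfun_const a"
    unfolding ratfun_const_mult[symmetric] by simp
  then show ?thesis
    unfolding ratfun_const_of_nat by (simp add: field_simps)
qed

lemma to_fract_power: "to_fract (a ^ n) = to_fract a ^ n"
  by (induction n) simp_all

lemma to_fract_monom_monom:
  "to_fract (monom (monom a j) i) = ratfun_const a * ratfun_x ^ i * ratfun_y ^ j"
proof -
  have "monom (monom a j) i = [:[:a:]:] * [:0, 1:] ^ i * [:[:0, 1:]:] ^ j"
    by (simp add: monom_altdef poly_const_pow)
  then show ?thesis
    by (simp only: ratfun_const_def ratfun_x_def ratfun_y_def to_fract_power to_fract_mult)
qed

lemma ratfun_y_nonzero [simp]: "ratfun_y \<noteq> 0"
  by (simp add: ratfun_y_def)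

text \<open>
  With indeterminates as weights, the mean weight is the joint probability generating function of
  the numbers of napkinless and frustrated guests.
\<close>

lemma mean_weight_eq_to_fract:
  fixes p q :: real
  assumes "0 \<le> p" "p \<le> 1" "q = 1 - p"
  shows "\<exists>c :: real poly poly.
     napkin_weights.mean_weight (ratfun_const p) (ratfun_const q) ratfun_x ratfun_y n {1..n} {1..n}
       = to_fract c \<and> (\<forall>i j. coeff (coeff c i) j = pr p i j n)"
proof -
  interpret napkin_weights "ratfun_const p" "ratfun_const q" ratfun_x ratfun_y
    using assms by unfold_locales (simp flip: ratfun_const_add)
  let ?count = "\<lambda>ks L o'. count_list (seating n (\<lambda>k. k \<in> L) {1..n} ks) o'"
  define c where "c = (\<Sum>ks\<in>permutations_of_set {1..n}. \<Sum>L\<in>Pow {1..n}.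
    monom (monom (p ^ card L * q ^ card ({1..n} - L) / fact n) (?count ks L Frustrated))
      (?count ks L Napkinless))"
  have "mean_weight n {1..n} {1..n} = (\<Sum>ks\<in>permutations_of_set {1..n}. \<Sum>L\<in>Pow {1..n}.
      outcome_weight n ks L {1..n} / fact n)"
    unfolding mean_weight_def sum_divide_distrib
    by (intro sum.cong refl)
       (auto simp: order_weight_eq_sum sum_divide_distrib permutations_of_set_def)
  also have "\<dots> = to_fract c"
    unfolding c_def to_fract_sum to_fract_monom_monom ratfun_const_divide_fact
      ratfun_const_mult ratfun_const_power
    by (intro sum.cong refl) (auto simp: outcome_weight_def permutations_of_set_def)
  moreover have "coeff (coeff c i) j = pr p i j n" for i j
    unfolding pr_eq_sum[OF assms(1,2)] c_def coeff_sum assms(3)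
    by (intro sum.cong refl) simp
  ultimately show ?thesis by auto
qed

theorem theorem3:
  fixes p q :: real and n :: nat
  assumes "0 < p" and "p < 1" and "q = 1 - p" and "n \<ge> 1"
  shows "\<exists>c :: real poly poly. fps_nth (gf_C p q) n = to_fract c \<and>
           (\<forall>i j. coeff (coeff c i) j = pr p i j n)"
proof -
  interpret napkin_weights "ratfun_const p" "ratfun_const q" ratfun_x ratfun_y
    using assms by unfold_locales (simp flip: ratfun_const_add)
  define G where "G = fps_const (ratfun_const p) * open_left + fps_const (ratfun_const q) * open_right"
  have nonzero: "ratfun_const p \<noteq> 0" "ratfun_const q \<noteq> 0"
    using assms by simp_all
  have D: "gf_D p q = denominator"
    by (simp add: gf_D_def denominator_def Let_def)
  have N: "gf_N p q = fps_X * numerator"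
    by (simp add: gf_N_def numerator_def Let_def mult_ac)
  \<comment> \<open>The constant term \<open>p q y\<^sup>3\<close> is invertible as a rational function.\<close>
  have D0: "denominator $ 0 \<noteq> 0"
    using nonzero by (simp add: denominator_nth_0)
  then have "denominator \<noteq> 0" by auto
  moreover have "fps_X * numerator = denominator * (fps_X * G)"
    using denominator_mult_segment_gf by (simp add: G_def mult_ac)
  ultimately have "gf_C p q = fps_X * G"
    unfolding gf_C_def D N by simp
  then have "fps_nth (gf_C p q) n = mean_weight n {1..n} {1..n}"
    unfolding mean_weight_circle[OF assms(4)] G_def using assms(4) by simp
  then show ?thesis
    using mean_weight_eq_to_fract[of p q n] assms by auto
qed

end
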